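(* Consider a network with routes of length one carrying integrated streaming and elastic traffic, with $\rho_i=\lambda_i/\mu_i$ satisfying the stability condition $\sum_{i\in I(J')}\rho_i<C(J')$ for all $J'\in\mathscr{SC}(J)$. A necessary and sufficient condition for the equilibrium point of the fluid limit to be in complete resource pooling is that $$\sum_{i\in I(J')^c}\rho_i-C(J'^c)>-\frac{\sum_{i\in I(J')^c}\kappa_i/\eta_i}{\sum_{i\in I(J')}\kappa_i/\eta_i}\Bigl(C(J')-\sum_{i\in I(J')}\rho_i\Bigr)$$ for all $J'\in\mathscr{SC}(J)$ with $J'\ne J$ (the inequality being regarded as satisfied, with right-hand side $-\infty$, if $I(J')=\emptyset$).
   Context: Network: $I$ is a finite nonempty set of users (flow types), $J$ a finite set of resources, resource $j$ has capacity $C_j>0$, and user $i$ can use exactly the resources in the nonempty set $J(i)\subseteq J$ (each route is a single resource). Elastic flows of type $i$ arrive at rate $\lambda_i>0$ with mean size $1/\mu_i$; streaming flows of type $i$ arrive at rate $\kappa_i>0$ with mean duration $1/\eta_i$. Optimal allocation: let $U$ be a strictly concave, strictly increasing, differentiable utility function common to all users. For a vector $\nu=(\nu_i)_{i\in I}$ of numbers of flows, $x(\nu)=(x_i)_{i\in I}$ is the solution of: maximize $\sum_{i} \nu_iU(x_i)$ subject to $\sum_{i: j\in J(i)} \nu_ix_i^j\le C_j$ for all $j\in J$; $\sum_{j\in J(i)}x_i^j=x_i$ for all $i$; $x_i^j\ge 0$ for $j\in J(i)$. With $n$ elastic and $m$ streaming flows, $x(n,m):=x(n+m)$ (both kinds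 are treated alike). Fluid limit: $n_i'(t)=\lambda_i-\mu_in_i(t)x_i(n(t),m(t))$, $m_i'(t)=\kappa_i-\eta_im_i(t)$. Its (unique) equilibrium point $(\hat n,\hat m)$ satisfies $\hat m_i=\kappa_i/\eta_i$ and $\hat n_ix_i(\hat n,\hat m)=\rho_i$. Complete resource pooling: a state with total flow numbers $\nu$ (here $\nu=n+m$) is in complete resource pooling if there is a neighbourhood of $\nu$ such that for each $\nu'$ in it, $x_i(\nu')=\sum_{j\in J}C_j/\sum_{i'\in I}\nu'_{i'}$ for all $i\in I$. Notation: for $J'\subseteq J$: $C(J')=\sum_{j\in J'}C_j$, $J'^c=J\setminus J'$, $I(J')=\{i\in I:J(i)\subseteq J'\}$, $I(J')^c=I\setminus I(J')$. Connectivity: a pair $(I',J')$ is connected if $J'$ cannot be partitioned into nonempty $J_1,J_2$ such that $I'$ can be partitioned into (possibly empty) $I_1,I_2$ with $J(i)\cap J_2=\emptyset$ for $i\in I_1$ and $J(i)\cap J_1=\emptyset$ for $i\in I_2$. A nonempty $J'\subseteq J$ is strongly connected if $(I(J'),J')$ is connected; $\mathscr{SC}(J)$ is the set of strongly connected subsets of $J$. *)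

theory Defs
  imports "HOL-Analysis.Analysis"
begin

text \<open>
  The set of users is the finite type \<open>'i\<close>, the set of resources the finite type \<open>'j\<close>;
  \<open>R i\<close> is the set \<open>J(i)\<close> of resources user \<open>i\<close> can use, and \<open>C j\<close> is the capacity
  of resource \<open>j\<close>.
\<close>

section \<open>Utility functions\<close>

text \<open>
  Only the values on the positive half-line matter, so that utilities that are unbounded
  below at 0, such as the logarithm, are included.
\<close>

definition strictly_concave_on :: "real set \<Rightarrow> (real \<Rightarrow> real) \<Rightarrow> bool" where
  "strictly_concave_on S f \<longleftrightarrow>
     convex S \<and>
     (\<forall>x\<in>S. \<forall>y\<in>S. \<forall>t. x \<noteq> y \<longrightarrow> 0 < t \<longrightarrow> t < 1 \<longrightarrow>
        (1 - t) * f x + t * f y < f ((1 - t) * x + t * y))"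

definition utility :: "(real \<Rightarrow> real) \<Rightarrow> bool" where
  "utility U \<longleftrightarrow>
     strictly_concave_on {0<..} U \<and> strict_mono_on {0<..} U \<and> (\<forall>x>0. U differentiable (at x))"

text \<open>
  At rate 0 the utility is its right limit, possibly \<open>-\<infinity>\<close>; for an increasing function
  that limit is the infimum.
\<close>

definition ext_utility :: "(real \<Rightarrow> real) \<Rightarrow> real \<Rightarrow> ereal" where
  "ext_utility U x = (if 0 < x then ereal (U x) else (INF y\<in>{0<..}. ereal (U y)))"

section \<open>Optimal allocation\<close>

text \<open>
  The number \<open>y i j\<close> is the rate \<open>x\<^sub>i\<^sup>j\<close> that a flow of user \<open>i\<close> obtains from resource \<open>j\<close>.
\<close>

definition feasible ::
    "('i::finite \<Rightarrow> 'j::finite set) \<Rightarrow> ('j \<Rightarrow> real) \<Rightarrow> real ^ 'i \<Rightarrow> real ^ 'i \<Rightarrow> bool" where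
  "feasible R C \<nu> x \<longleftrightarrow>
     (\<exists>y :: 'i \<Rightarrow> 'j \<Rightarrow> real.
        (\<forall>j. (\<Sum>i | j \<in> R i. \<nu> $ i * y i j) \<le> C j) \<and>
        (\<forall>i. (\<Sum>j\<in>R i. y i j) = x $ i) \<and>
        (\<forall>i. \<forall>j\<in>R i. 0 \<le> y i j))"

definition total_utility :: "(real \<Rightarrow> real) \<Rightarrow> real ^ 'i::finite \<Rightarrow> real ^ 'i \<Rightarrow> ereal" where
  "total_utility U \<nu> x = (\<Sum>i\<in>UNIV. ereal (\<nu> $ i) * ext_utility U (x $ i))"

definition optimal_allocation ::
    "(real \<Rightarrow> real) \<Rightarrow> ('i::finite \<Rightarrow> 'j::finite set) \<Rightarrow> ('j \<Rightarrow> real) \<Rightarrow>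
     real ^ 'i \<Rightarrow> real ^ 'i \<Rightarrow> bool" where
  "optimal_allocation U R C \<nu> x \<longleftrightarrow>
     feasible R C \<nu> x \<and>
     (\<forall>x'. feasible R C \<nu> x' \<longrightarrow> total_utility U \<nu> x' \<le> total_utility U \<nu> x)"

text \<open>
  The maximiser \<open>x(\<nu>)\<close> is unique when all components of \<open>\<nu>\<close> are positive (the individual
  \<open>x\<^sub>i\<^sup>j\<close> need not be). If \<open>\<nu>\<^sub>i = 0\<close>, the rate of user \<open>i\<close> is not constrained
  by the problem.
\<close>

definition allocation ::
    "(real \<Rightarrow> real) \<Rightarrow> ('i::finite \<Rightarrow> 'j::finite set) \<Rightarrow> ('j \<Rightarrow> real) \<Rightarrow>
     real ^ 'i \<Rightarrow> real ^ 'i" where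
  "allocation U R C \<nu> = (THE x. optimal_allocation U R C \<nu> x)"

section \<open>Fluid limit and complete resource pooling\<close>

text \<open>
  The right-hand side of the differential equation for the pair \<open>(n, m)\<close> of numbers of elastic
  and streaming flows.
\<close>

definition fluid_drift ::
    "(real \<Rightarrow> real) \<Rightarrow> ('i::finite \<Rightarrow> 'j::finite set) \<Rightarrow> ('j \<Rightarrow> real) \<Rightarrow>
     ('i \<Rightarrow> real) \<Rightarrow> ('i \<Rightarrow> real) \<Rightarrow> ('i \<Rightarrow> real) \<Rightarrow> ('i \<Rightarrow> real) \<Rightarrow>
     (real ^ 'i) \<times> (real ^ 'i) \<Rightarrow> (real ^ 'i) \<times> (real ^ 'i)" where
  "fluid_drift U R C lam mu kap eta = (\<lambda>(n, m).
     (\<chi> i. lam i - mu i * n $ i * allocation U R C (n + m) $ i,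
      \<chi> i. kap i - eta i * m $ i))"

definition fluid_equilibrium ::
    "(real \<Rightarrow> real) \<Rightarrow> ('i::finite \<Rightarrow> 'j::finite set) \<Rightarrow> ('j \<Rightarrow> real) \<Rightarrow>
     ('i \<Rightarrow> real) \<Rightarrow> ('i \<Rightarrow> real) \<Rightarrow> ('i \<Rightarrow> real) \<Rightarrow> ('i \<Rightarrow> real) \<Rightarrow>
     real ^ 'i \<Rightarrow> real ^ 'i \<Rightarrow> bool" where
  "fluid_equilibrium U R C lam mu kap eta n m \<longleftrightarrow>
     (\<forall>i. 0 \<le> n $ i) \<and> (\<forall>i. 0 \<le> m $ i) \<and>
     fluid_drift U R C lam mu kap eta (n, m) = (0, 0)"

text \<open>
  This is meant for states with \<open>\<nu>\<^sub>i > 0\<close> for all \<open>i\<close>, for which all sufficiently small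
  neighbourhoods in \<open>real ^ 'i\<close> consist of such states.
\<close>

definition complete_resource_pooling ::
    "(real \<Rightarrow> real) \<Rightarrow> ('i::finite \<Rightarrow> 'j::finite set) \<Rightarrow> ('j \<Rightarrow> real) \<Rightarrow> real ^ 'i \<Rightarrow> bool" where
  "complete_resource_pooling U R C \<nu> \<longleftrightarrow>
     (\<exists>S. open S \<and> \<nu> \<in> S \<and>
        (\<forall>\<nu>'\<in>S. \<forall>i. allocation U R C \<nu>' $ i = (\<Sum>j\<in>UNIV. C j) / (\<Sum>i'\<in>UNIV. \<nu>' $ i')))"

section \<open>Connectivity\<close>

definition users_within :: "('i \<Rightarrow> 'j set) \<Rightarrow> 'j set \<Rightarrow> 'i set" where
  "users_within R J' = {i. R i \<subseteq> J'}"

definition connected_pair :: "('i \<Rightarrow> 'j set) \<Rightarrow> 'i set \<Rightarrow> 'j set \<Rightarrow> bool" where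
  "connected_pair R I' J' \<longleftrightarrow>
     \<not> (\<exists>J1 J2. J1 \<noteq> {} \<and> J2 \<noteq> {} \<and> J1 \<union> J2 = J' \<and> J1 \<inter> J2 = {} \<and>
          (\<exists>I1 I2. I1 \<union> I2 = I' \<and> I1 \<inter> I2 = {} \<and>
             (\<forall>i\<in>I1. R i \<inter> J2 = {}) \<and> (\<forall>i\<in>I2. R i \<inter> J1 = {})))"

definition strongly_connected_sets :: "('i \<Rightarrow> 'j set) \<Rightarrow> 'j set set" where
  "strongly_connected_sets R = {J'. J' \<noteq> {} \<and> connected_pair R (users_within R J') J'}"

end

theory Submission
  imports Defs
begin

text \<open>
  Let \<open>x\<close> be the optimal allocation for positive flow numbers \<open>\<nu>\<close>. By concavity, every user of a
  resource that serves user \<open>i\<close> has at least the rate \<open>x\<^sub>i\<close>. Hence the resources \<open>J'\<close> reachable by the users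
  of minimal rate \<open>a\<close> are used up by exactly those users, \<open>I(J')\<close>, so that \<open>a \<nu>(I(J')) = C(J')\<close>, while
  \<open>a \<nu>(I) \<le> C(J)\<close>. All rates are therefore equal as soon as \<open>\<nu>(I(J')) C(J) < C(J') \<nu>(I)\<close> for all proper
  \<open>J'\<close> with users. Conversely the weak inequalities hold wherever \<open>C(J) / \<nu>(I)\<close> is feasible for
  everybody, and they are strict at interior points, since adding flows in \<open>I(J')\<close> would break an equality.

  At the equilibrium \<open>\<nu>\<^sub>i x\<^sub>i = \<rho>\<^sub>i + m\<^sub>i x\<^sub>i\<close> with \<open>m\<^sub>i = \<kappa>\<^sub>i / \<eta>\<^sub>i\<close>. If all rates are equal, this turns the cut
  inequality into \<open>m(I(J')) (C(J) - \<rho>(I)) < m(I) (C(J') - \<rho>(I(J')))\<close>, a rearrangement of the stated one.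
  This form is additive in \<open>J'\<close>, so it passes from strongly connected sets to all proper subsets,
  and then it excludes any bottleneck \<open>J' \<noteq> J\<close> at the equilibrium, which forces equal rates.
\<close>

section \<open>The utility at rate zero\<close>

lemma ext_utility_not_PInf: "ext_utility U x \<noteq> \<infinity>"
proof -
  have "(INF y\<in>{0<..}. ereal (U y)) \<le> ereal (U 1)"
    by (rule INF_lower) simp
  then show ?thesis
    by (auto simp: ext_utility_def)
qed

lemma ext_utility_0_le: "0 < y \<Longrightarrow> ext_utility U 0 \<le> ereal (U y)"
  by (auto simp: ext_utility_def intro: INF_lower)

lemma ext_utility_less:
  assumes "utility U" "0 \<le> x" "x < y"
  shows "ext_utility U x < ext_utility U y"
proof -
  have mono: "U a < U b" if "0 < a" "a < b" for a b
    using assms(1) that by (auto simp: utility_def strict_mono_on_def)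
  show ?thesis
  proof (cases "0 < x")
    case True
    then show ?thesis using mono[of x y] assms by (simp add: ext_utility_def)
  next
    case False
    then have "x = 0" "0 < y" using assms by auto
    \<comment> \<open>The infimum alone gives only a weak bound; the intermediate point
      \<open>y / 2\<close> makes it strict.\<close>
    then have "ext_utility U x \<le> ereal (U (y / 2))"
      using ext_utility_0_le[of "y / 2" U] by simp
    also have "\<dots> < ereal (U y)"
      using mono[of "y / 2" y] \<open>0 < y\<close> by simp
    finally show ?thesis using \<open>0 < y\<close> by (simp add: ext_utility_def)
  qed
qed

lemma utility_isCont: "utility U \<Longrightarrow> 0 < x \<Longrightarrow> isCont U x"
  by (simp add: utility_def differentiable_imp_continuous_within)

text \<open>Away from 0 this is the continuity of \<open>U\<close>. At 0 the value is the infimum,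
  which an increasing function approaches from the right, even if it is
  \<open>- \<infinity>\<close>.\<close>

lemma continuous_on_ext_utility:
  assumes "utility U"
  shows "continuous_on {0..} (ext_utility U)"
  unfolding continuous_on_def
proof
  fix x :: real
  assume x: "x \<in> {0..}"
  show "(ext_utility U \<longlongrightarrow> ext_utility U x) (at x within {0..})"
  proof (cases "0 < x")
    case True
    have "((\<lambda>z. ereal (U z)) \<longlongrightarrow> ereal (U x)) (at x)"
      using utility_isCont[OF assms True] by (simp add: isCont_def)
    then have "((\<lambda>z. ereal (U z)) \<longlongrightarrow> ext_utility U x) (at x)"
      using True by (simp add: ext_utility_def)
    moreover have "\<forall>\<^sub>F z in at x. ereal (U z) = ext_utility U z"
      using order_tendstoD(1)[OF tendsto_ident_at True]
      by eventually_elim (simp add: ext_utility_def)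
    ultimately have "(ext_utility U \<longlongrightarrow> ext_utility U x) (at x)"
      by (rule Lim_transform_eventually)
    then show ?thesis
      by (rule filterlim_mono) (auto intro: at_le)
  next
    case False
    then have x0: "x = 0" using x by simp
    show ?thesis
      unfolding x0
    proof (rule order_tendstoI)
      fix a
      assume "a < ext_utility U 0"
      then show "\<forall>\<^sub>F z in at 0 within {0..}. a < ext_utility U z"
        unfolding eventually_at_filter
        by (intro always_eventually)
          (auto intro: less_trans[OF _ ext_utility_less[OF assms order_refl]])
    next
      fix a
      assume "ext_utility U 0 < a"
      then obtain y where y: "0 < y" "ereal (U y) < a"
        by (auto simp: ext_utility_def INF_less_iff)
      have "\<forall>\<^sub>F z in at 0 within {0..}. z < y"
        by (rule order_tendstoD(2)[OF tendsto_ident_at y(1)])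
      moreover have "\<forall>\<^sub>F z in at (0::real) within {0..}. 0 \<le> z"
        by (simp add: eventually_at_filter)
      ultimately show "\<forall>\<^sub>F z in at 0 within {0..}. ext_utility U z < a"
      proof eventually_elim
        case (elim z)
        then have "ext_utility U z < ereal (U y)"
          using ext_utility_less[OF assms, of z y] y by (simp add: ext_utility_def)
        then show ?case using y(2) by simp
      qed
    qed
  qed
qed

lemma utility_strictly_concave:
  assumes "utility U" "0 < x" "0 < y" "x \<noteq> y" "0 < t" "t < 1"
  shows "(1 - t) * U x + t * U y < U ((1 - t) * x + t * y)"
  using assms by (auto simp: utility_def strictly_concave_on_def)

text \<open>Letting the left end point tend to 0 preserves only the weak inequality. Strictness
  comes back from the segment between \<open>t / 2 * y\<close> and \<open>y\<close>, whose end
  points are both positive.\<close>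

lemma ext_utility_concave_at_0:
  assumes U: "utility U" and y: "0 < y" and a: "ext_utility U 0 = ereal a"
    and t: "0 < t" "t < 1"
  shows "(1 - t) * a + t * U y < U (t * y)"
proof -
  have weak: "(1 - s) * a + s * U y \<le> U (s * y)" if s: "0 < s" "s < 1" for s
  proof (rule tendsto_lowerbound)
    have "isCont (\<lambda>e. U ((1 - s) * e + s * y)) 0"
      by (rule isCont_o2[where g = U])
        (use s y in \<open>auto intro!: continuous_intros utility_isCont[OF U]\<close>)
    then have "(\<lambda>e. U ((1 - s) * e + s * y)) \<midarrow>0\<rightarrow> U (s * y)"
      by (simp add: isCont_def)
    then show "((\<lambda>e. U ((1 - s) * e + s * y)) \<longlongrightarrow> U (s * y)) (at_right 0)"
      by (rule filterlim_mono) (auto intro: at_le)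
    show "\<forall>\<^sub>F e in at_right 0. (1 - s) * a + s * U y \<le> U ((1 - s) * e + s * y)"
      using eventually_at_right_less order_tendstoD(2)[OF tendsto_ident_at y]
    proof eventually_elim
      case (elim e)
      have "(1 - s) * a \<le> (1 - s) * U e"
        using ext_utility_0_le[of e U] a elim s by (intro mult_left_mono) auto
      then show ?case
        using utility_strictly_concave[OF U, of e y s] elim y s by linarith
    qed
  qed simp
  \<comment> \<open>The weight for which \<open>t * y\<close> is the combination of
    \<open>t / 2 * y\<close> and \<open>y\<close> with weights \<open>1 - s\<close> and
    \<open>s\<close>.\<close>
  define s where "s = t / (2 - t)"
  have s: "0 < s" "s < 1" "(1 - s) * (t / 2) + s = t"
  proof -
    have t2: "0 < 2 - t" using t by simp
    show "0 < s" "s < 1" using t by (auto simp: s_def)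
    have "s * (2 - t) = t" using t2 by (simp add: s_def)
    then show "(1 - s) * (t / 2) + s = t" by (simp add: field_simps)
  qed
  have "(1 - t) * a + t * U y = (1 - s) * ((1 - t / 2) * a + (t / 2) * U y) + s * U y"
  proof -
    have "(1 - s) * ((1 - t / 2) * a + (t / 2) * U y) + s * U y =
        (1 - ((1 - s) * (t / 2) + s)) * a + ((1 - s) * (t / 2) + s) * U y"
      by (simp add: algebra_simps)
    then show ?thesis by (simp only: s(3))
  qed
  also have "\<dots> \<le> (1 - s) * U (t / 2 * y) + s * U y"
    using weak[of "t / 2"] s t by (intro add_right_mono mult_left_mono) auto
  also have "\<dots> < U ((1 - s) * (t / 2 * y) + s * y)"
    using t y s by (intro utility_strictly_concave[OF U]) auto
  also have "(1 - s) * (t / 2 * y) + s * y = ((1 - s) * (t / 2) + s) * y"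
    by (simp add: algebra_simps)
  finally show ?thesis by (simp only: s(3))
qed

lemma ext_utility_strictly_concave:
  assumes U: "utility U" and xy: "0 \<le> x" "0 \<le> y" "x \<noteq> y"
    and a: "ext_utility U x = ereal a" and b: "ext_utility U y = ereal b"
    and t: "0 < t" "t < 1"
  shows "ereal ((1 - t) * a + t * b) < ext_utility U ((1 - t) * x + t * y)"
proof -
  have pos: "0 < (1 - t) * x + t * y"
    using xy t by (metis add_nonneg_pos add_pos_nonneg diff_gt_0_iff_gt less_eq_real_def
        mult_nonneg_nonneg mult_pos_pos)
  consider "0 < x" "0 < y" | "x = 0" "0 < y" | "0 < x" "y = 0"
    using xy by linarith
  then have "(1 - t) * a + t * b < U ((1 - t) * x + t * y)"
  proof cases
    case 1
    then show ?thesis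
      using utility_strictly_concave[OF U _ _ xy(3) t] a b by (simp add: ext_utility_def)
  next
    case 2
    then show ?thesis
      using ext_utility_concave_at_0[OF U _ _ t, of y a] a b by (simp add: ext_utility_def)
  next
    case 3
    then show ?thesis
      using ext_utility_concave_at_0[OF U, of x b "1 - t"] a b t
      by (simp add: ext_utility_def algebra_simps)
  qed
  then show ?thesis using pos by (simp add: ext_utility_def)
qed

section \<open>Total utility as a sum of extended reals\<close>

lemma total_utility_real:
  assumes "\<And>i. ext_utility U (x $ i) = ereal (u i)"
  shows "total_utility U \<nu> x = ereal (\<Sum>i\<in>UNIV. \<nu> $ i * u i)"
  by (simp add: total_utility_def assms)

lemma total_utility_eq_MInf:
  assumes "ext_utility U (x $ k) = - \<infinity>" "0 < \<nu> $ k"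
    and "\<And>i. 0 \<le> \<nu> $ i"
  shows "total_utility U \<nu> x = - \<infinity>"
proof -
  have fin: "ereal (\<nu> $ i) * ext_utility U (x $ i) \<noteq> \<infinity>" for i
    using ext_utility_not_PInf[of U "x $ i"] assms(3)[of i]
    by (cases "ext_utility U (x $ i)") auto
  \<comment> \<open>In \<open>ereal\<close> the sum of \<open>\<infinity>\<close> and
    \<open>- \<infinity>\<close> is \<open>\<infinity>\<close>, so the other summands have to be
    kept away from \<open>\<infinity>\<close>.\<close>
  have "(\<Sum>i\<in>UNIV - {k}. ereal (\<nu> $ i) * ext_utility U (x $ i)) \<noteq> \<infinity>"
    using fin by (auto simp: sum_Pinfty)
  then show ?thesis
    unfolding total_utility_def
    by (subst sum.remove[of _ k]) (use assms in auto)
qed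

section \<open>Routings\<close>

text \<open>The witness in \<open>feasible\<close> made explicit, so that one fixed split of the
  rates over the resources can be examined and perturbed.\<close>

definition routing ::
    "('i::finite \<Rightarrow> 'j::finite set) \<Rightarrow> ('j \<Rightarrow> real) \<Rightarrow> real ^ 'i \<Rightarrow> real ^ 'i \<Rightarrow>
     ('i \<Rightarrow> 'j \<Rightarrow> real) \<Rightarrow> bool" where
  "routing R C \<nu> x y \<longleftrightarrow>
     (\<forall>j. (\<Sum>i | j \<in> R i. \<nu> $ i * y i j) \<le> C j) \<and>
     (\<forall>i. (\<Sum>j\<in>R i. y i j) = x $ i) \<and>
     (\<forall>i. \<forall>j\<in>R i. 0 \<le> y i j)"

lemma feasible_iff_routing: "feasible R C \<nu> x \<longleftrightarrow> (\<exists>y. routing R C \<nu> x y)"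
  by (simp add: feasible_def routing_def)

lemma feasible_nonneg: "feasible R C \<nu> x \<Longrightarrow> 0 \<le> x $ i"
  unfolding feasible_def by (metis sum_nonneg)

lemma sum_routes_swap:
  fixes R :: "'i::finite \<Rightarrow> 'j::finite set" and f :: "'i \<Rightarrow> 'j \<Rightarrow> real"
  shows "(\<Sum>j\<in>J'. \<Sum>i | j \<in> R i. f i j) = (\<Sum>i\<in>UNIV. \<Sum>j\<in>R i \<inter> J'. f i j)"
  using sum.swap_restrict[of J' UNIV "\<lambda>j i. f i j" "\<lambda>j i. j \<in> R i"]
  by (simp add: Int_def conj_commute)

text \<open>The users in \<open>users_within R J'\<close> draw their whole rate from
  \<open>J'\<close>, so their demand is part of the load on \<open>J'\<close>.\<close>

lemma feasible_cut:
  assumes "feasible R C \<nu> x" "\<And>i. 0 \<le> \<nu> $ i"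
  shows "(\<Sum>i\<in>users_within R J'. \<nu> $ i * x $ i) \<le> (\<Sum>j\<in>J'. C j)"
proof -
  obtain y where y: "\<And>j. (\<Sum>i | j \<in> R i. \<nu> $ i * y i j) \<le> C j"
      "\<And>i. (\<Sum>j\<in>R i. y i j) = x $ i" "\<And>i j. j \<in> R i \<Longrightarrow> 0 \<le> y i j"
    using assms(1) unfolding feasible_def by blast
  have "(\<Sum>i\<in>users_within R J'. \<nu> $ i * x $ i) =
      (\<Sum>i\<in>users_within R J'. \<Sum>j\<in>R i \<inter> J'. \<nu> $ i * y i j)"
    by (intro sum.cong refl) (auto simp: users_within_def Int_absorb2 y(2) sum_distrib_left[symmetric])
  also have "\<dots> \<le> (\<Sum>i\<in>UNIV. \<Sum>j\<in>R i \<inter> J'. \<nu> $ i * y i j)"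
    using assms(2) y(3) by (intro sum_mono2) (auto intro!: sum_nonneg)
  also have "\<dots> = (\<Sum>j\<in>J'. \<Sum>i | j \<in> R i. \<nu> $ i * y i j)"
    by (rule sum_routes_swap[symmetric])
  also have "\<dots> \<le> (\<Sum>j\<in>J'. C j)"
    by (intro sum_mono y(1))
  finally show ?thesis .
qed

text \<open>Only the rates at the single resource \<open>j\<close> change, so only its load needs
  checking. The perturbations that contradict optimality below have this form.\<close>

lemma routing_shift:
  assumes y: "routing R C \<nu> x y"
    and d: "\<And>i. j \<notin> R i \<Longrightarrow> d i = 0" "\<And>i. 0 \<le> y i j + d i \<or> j \<notin> R i"
    and load: "(\<Sum>i | j \<in> R i. \<nu> $ i * (y i j + d i)) \<le> C j"
  shows "feasible R C \<nu> (\<chi> i. x $ i + d i)"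
proof -
  define y' where "y' i k = y i k + (if k = j then d i else 0)" for i k
  have "(\<Sum>i | k \<in> R i. \<nu> $ i * y' i k) \<le> C k" for k
    using y load by (cases "k = j") (auto simp: y'_def routing_def)
  moreover have "(\<Sum>k\<in>R i. y' i k) = x $ i + d i" for i
    using y d(1)[of i] by (auto simp: y'_def routing_def sum.distrib)
  moreover have "0 \<le> y' i k" if "k \<in> R i" for i k
    using y d(2)[of i] that by (auto simp: y'_def routing_def)
  ultimately show ?thesis
    by (auto simp: feasible_def intro!: exI[of _ y'])
qed

lemma feasible_convex:
  assumes "feasible R C \<nu> x" "feasible R C \<nu> x'" "0 \<le> t" "t \<le> 1"
  shows "feasible R C \<nu> ((1 - t) *\<^sub>R x + t *\<^sub>R x')"
proof -
  obtain y y' where y: "routing R C \<nu> x y" "routing R C \<nu> x' y'"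
    using assms by (auto simp: feasible_iff_routing)
  define z where "z i j = (1 - t) * y i j + t * y' i j" for i j
  have "(\<Sum>i | j \<in> R i. \<nu> $ i * z i j) \<le> C j" for j
  proof -
    have "(\<Sum>i | j \<in> R i. \<nu> $ i * z i j) =
        (1 - t) * (\<Sum>i | j \<in> R i. \<nu> $ i * y i j) + t * (\<Sum>i | j \<in> R i. \<nu> $ i * y' i j)"
      by (simp add: z_def sum_distrib_left sum.distrib[symmetric] algebra_simps)
    also have "\<dots> \<le> C j"
      using y assms by (intro convex_bound_le) (auto simp: routing_def)
    finally show ?thesis .
  qed
  moreover have "(\<Sum>j\<in>R i. z i j) = (1 - t) * x $ i + t * x' $ i" for i
    using y by (simp add: z_def routing_def sum.distrib sum_distrib_left[symmetric])
  moreover have "0 \<le> z i j" if "j \<in> R i" for i j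
    using y assms that by (auto simp: z_def routing_def)
  ultimately show ?thesis
    unfolding feasible_def by (intro exI[of _ z]) auto
qed

text \<open>Each flow takes the fraction \<open>1 / s\<close> of every resource it can use, where
  \<open>s\<close> is the total number of flows.\<close>

lemma feasible_positive_exists:
  fixes R :: "'i::finite \<Rightarrow> 'j::finite set"
  assumes routes: "\<And>i. R i \<noteq> {}" and C: "\<And>j. 0 < C j" and \<nu>: "\<And>i. 0 < \<nu> $ i"
  obtains x where "feasible R C \<nu> x" "\<And>i. 0 < x $ i"
proof -
  define s where "s = (\<Sum>i\<in>UNIV. \<nu> $ i)"
  have s: "0 < s" unfolding s_def using \<nu> by (intro sum_pos) auto
  have "routing R C \<nu> (\<chi> i. \<Sum>j\<in>R i. C j / s) (\<lambda>i j. C j / s)"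
  proof -
    have "(\<Sum>i | j \<in> R i. \<nu> $ i * (C j / s)) \<le> C j" for j
    proof -
      have "(\<Sum>i | j \<in> R i. \<nu> $ i * (C j / s)) \<le> (\<Sum>i\<in>UNIV. \<nu> $ i * (C j / s))"
        using \<nu> C[of j] s by (intro sum_mono2) (auto simp: less_imp_le)
      also have "\<dots> = C j"
        using s by (simp only: sum_distrib_right[symmetric] s_def[symmetric]) simp
      finally show ?thesis .
    qed
    then show ?thesis
      using C s by (auto simp: routing_def less_imp_le)
  qed
  then have "feasible R C \<nu> (\<chi> i. \<Sum>j\<in>R i. C j / s)"
    by (auto simp: feasible_iff_routing)
  moreover have "0 < (\<chi> i. \<Sum>j\<in>R i. C j / s) $ i" for i
    using C s routes by (auto intro!: sum_pos)
  ultimately show ?thesis using that by blast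
qed

section \<open>Existence and uniqueness of the optimal allocation\<close>

text \<open>The feasible set is a linear image of a closed bounded set of rate matrices; positive
  flow numbers bound each rate by a capacity.\<close>

lemma compact_feasible:
  fixes R :: "'i::finite \<Rightarrow> 'j::finite set"
  assumes \<nu>: "\<And>i. 0 < \<nu> $ i"
  shows "compact {x. feasible R C \<nu> x}"
proof -
  \<comment> \<open>Entries off the routes are unconstrained in \<open>feasible\<close>; requiring
    them to be 0 keeps \<open>K\<close> bounded and does not change the image.\<close>
  define K :: "(real ^ 'j ^ 'i) set" where
    "K = {Y. (\<forall>i j. 0 \<le> Y $ i $ j) \<and> (\<forall>i j. j \<notin> R i \<longrightarrow> Y $ i $ j = 0) \<and>
           (\<forall>j. (\<Sum>i | j \<in> R i. \<nu> $ i * Y $ i $ j) \<le> C j)}"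
  have "closed K"
    unfolding K_def
    by (intro closed_Collect_conj closed_Collect_all closed_Collect_imp open_Collect_const
        closed_Collect_le closed_Collect_eq continuous_intros)
  moreover have "bounded K"
  proof (rule boundedI)
    fix Y assume Y: "Y \<in> K"
    have le: "\<bar>Y $ i $ j\<bar> \<le> \<bar>C j\<bar> / \<nu> $ i" for i j
    proof (cases "j \<in> R i")
      case True
      have "\<nu> $ i * Y $ i $ j \<le> (\<Sum>i | j \<in> R i. \<nu> $ i * Y $ i $ j)"
        using Y \<nu> True by (intro member_le_sum) (auto simp: K_def less_imp_le)
      also have "\<dots> \<le> C j" using Y by (simp add: K_def)
      finally show ?thesis
        using Y \<nu>[of i] by (simp add: K_def field_simps)
    next
      case False
      then show ?thesis using Y \<nu>[of i] by (simp add: K_def)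
    qed
    have "norm Y \<le> (\<Sum>i\<in>UNIV. norm (Y $ i))"
      unfolding norm_vec_def by (rule L2_set_le_sum) simp
    also have "\<dots> \<le> (\<Sum>i\<in>UNIV. \<Sum>j\<in>UNIV. \<bar>Y $ i $ j\<bar>)"
      by (intro sum_mono norm_le_l1_cart)
    also have "\<dots> \<le> (\<Sum>i\<in>UNIV. \<Sum>j\<in>UNIV. \<bar>C j\<bar> / \<nu> $ i)"
      by (intro sum_mono le)
    finally show "norm Y \<le> (\<Sum>i\<in>UNIV. \<Sum>j\<in>UNIV. \<bar>C j\<bar> / \<nu> $ i)" .
  qed
  ultimately have "compact K" by (simp add: compact_eq_bounded_closed)
  then have "compact ((\<lambda>Y. \<chi> i. \<Sum>j\<in>R i. Y $ i $ j) ` K)"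
    by (intro compact_continuous_image continuous_on_vec_lambda continuous_intros)
  moreover have "(\<lambda>Y. \<chi> i. \<Sum>j\<in>R i. Y $ i $ j) ` K = {x. feasible R C \<nu> x}"
  proof (intro equalityI subsetI)
    fix x assume "x \<in> (\<lambda>Y. \<chi> i. \<Sum>j\<in>R i. Y $ i $ j) ` K"
    then obtain Y where "Y \<in> K" "x = (\<chi> i. \<Sum>j\<in>R i. Y $ i $ j)" by auto
    then show "x \<in> {x. feasible R C \<nu> x}"
      by (auto simp: feasible_def K_def intro!: exI[of _ "\<lambda>i j. Y $ i $ j"])
  next
    fix x assume "x \<in> {x. feasible R C \<nu> x}"
    then obtain y where y: "routing R C \<nu> x y" by (auto simp: feasible_iff_routing)
    define Y :: "real ^ 'j ^ 'i" where "Y = (\<chi> i j. if j \<in> R i then y i j else 0)"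
    have "Y \<in> K" using y by (auto simp: Y_def K_def routing_def)
    moreover have "x = (\<chi> i. \<Sum>j\<in>R i. Y $ i $ j)"
      using y by (simp add: Y_def routing_def vec_eq_iff)
    ultimately show "x \<in> (\<lambda>Y. \<chi> i. \<Sum>j\<in>R i. Y $ i $ j) ` K" by blast
  qed
  ultimately show ?thesis by simp
qed

text \<open>Addition on \<open>ereal\<close> is discontinuous where \<open>\<infinity>\<close> meets
  \<open>- \<infinity>\<close>; excluding the value \<open>\<infinity>\<close> avoids those
  points.\<close>

lemma continuous_on_sum_ereal:
  fixes f :: "'a \<Rightarrow> 'b::topological_space \<Rightarrow> ereal"
  assumes "finite A" "\<And>i. i \<in> A \<Longrightarrow> continuous_on S (f i)"
    and "\<And>i x. i \<in> A \<Longrightarrow> x \<in> S \<Longrightarrow> f i x \<noteq> \<infinity>"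
  shows "continuous_on S (\<lambda>x. \<Sum>i\<in>A. f i x)"
  using assms
proof (induction A rule: finite_induct)
  case empty
  then show ?case by simp
next
  case (insert k A)
  then have "continuous_on S (\<lambda>x. \<Sum>i\<in>A. f i x)" "continuous_on S (f k)" by auto
  moreover have "(\<Sum>i\<in>A. f i x) \<noteq> \<infinity>" "f k x \<noteq> \<infinity>" if "x \<in> S" for x
    using insert that by (auto simp: sum_Pinfty)
  ultimately have "continuous_on S (\<lambda>x. f k x + (\<Sum>i\<in>A. f i x))"
    unfolding continuous_on_def
    by (intro ballI tendsto_add_ereal_general) auto
  then show ?case using insert by simp
qed

lemma continuous_on_total_utility:
  fixes \<nu> :: "real ^ 'i::finite"
  assumes "utility U" "\<And>i. 0 \<le> \<nu> $ i"
  shows "continuous_on {x. \<forall>i. 0 \<le> x $ i} (total_utility U \<nu>)"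
  unfolding total_utility_def
proof (rule continuous_on_sum_ereal)
  fix i :: 'i
  have "continuous_on {x. \<forall>i. 0 \<le> x $ i} (\<lambda>x. ext_utility U (x $ i))"
    by (rule continuous_on_compose2[OF continuous_on_ext_utility[OF assms(1)]])
      (auto intro!: continuous_intros)
  then show "continuous_on {x. \<forall>i. 0 \<le> x $ i} (\<lambda>x. ereal (\<nu> $ i) * ext_utility U (x $ i))"
    unfolding continuous_on_def by (auto intro!: tendsto_cmult_ereal)
next
  fix i :: 'i and x :: "real ^ 'i"
  show "ereal (\<nu> $ i) * ext_utility U (x $ i) \<noteq> \<infinity>"
    using ext_utility_not_PInf[of U "x $ i"] assms(2)[of i]
    by (cases "ext_utility U (x $ i)") auto
qed simp

lemma optimal_allocation_exists:
  assumes "utility U" "\<And>i. R i \<noteq> {}" "\<And>j. 0 < C j" "\<And>i. 0 < \<nu> $ i"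
  shows "\<exists>x. optimal_allocation U R C \<nu> x"
proof -
  have "continuous_on {x. feasible R C \<nu> x} (total_utility U \<nu>)"
    by (rule continuous_on_subset[OF continuous_on_total_utility])
      (use assms feasible_nonneg in \<open>auto simp: less_imp_le\<close>)
  moreover obtain z where "feasible R C \<nu> z"
    by (rule feasible_positive_exists[OF assms(2,3,4)])
  then have "{x. feasible R C \<nu> x} \<noteq> {}" by auto
  ultimately obtain x where "feasible R C \<nu> x"
      "\<forall>z\<in>{x. feasible R C \<nu> x}. total_utility U \<nu> z \<le> total_utility U \<nu> x"
    using continuous_attains_sup[OF compact_feasible[OF assms(4)]] by blast
  then show ?thesis
    by (auto simp: optimal_allocation_def)
qed

text \<open>An allocation with all rates positive has finite total utility, so the optimal total is
  not \<open>- \<infinity>\<close>, and then neither is any of its summands.\<close>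

lemma optimal_allocation_finite:
  assumes "\<And>i. R i \<noteq> {}" "\<And>j. 0 < C j" "\<And>i. 0 < \<nu> $ i"
    and opt: "optimal_allocation U R C \<nu> x"
  obtains u where "\<And>i. ext_utility U (x $ i) = ereal (u i)"
proof -
  obtain x' where x': "feasible R C \<nu> x'" "\<And>i. 0 < x' $ i"
    using feasible_positive_exists[of R C \<nu>, OF assms(1,2,3)] by blast
  have "total_utility U \<nu> x' = ereal (\<Sum>i\<in>UNIV. \<nu> $ i * U (x' $ i))"
    using x'(2) by (intro total_utility_real) (simp add: ext_utility_def)
  moreover have "total_utility U \<nu> x' \<le> total_utility U \<nu> x"
    using opt x'(1) by (simp add: optimal_allocation_def)
  ultimately have "total_utility U \<nu> x \<noteq> - \<infinity>" by auto
  then have "ext_utility U (x $ i) \<noteq> - \<infinity>" for i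
    using total_utility_eq_MInf[of U x i \<nu>] assms(3) by (auto simp: less_imp_le)
  then have "\<exists>u. ext_utility U (x $ i) = ereal u" for i
    using ext_utility_not_PInf[of U "x $ i"] by (cases "ext_utility U (x $ i)") auto
  then show ?thesis using that by metis
qed

text \<open>Criterion for improving on \<open>x\<close>: the real numbers \<open>w\<close> are lower
  bounds for the utilities at \<open>x'\<close>, obtained from concavity or monotonicity, so that
  sums over \<open>ereal\<close> need not be compared directly.\<close>

lemma total_utility_less:
  assumes u: "\<And>i. ext_utility U (x $ i) = ereal (u i)"
    and \<nu>: "\<And>i. 0 < \<nu> $ i"
    and le: "\<And>i. ereal (w i) \<le> ext_utility U (x' $ i)"
    and less: "ereal (w k) < ext_utility U (x' $ k)"
    and sums: "(\<Sum>i\<in>UNIV. \<nu> $ i * u i) \<le> (\<Sum>i\<in>UNIV. \<nu> $ i * w i)"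
  shows "total_utility U \<nu> x < total_utility U \<nu> x'"
proof -
  have "\<exists>v. ext_utility U (x' $ i) = ereal v" for i
    using ext_utility_not_PInf[of U "x' $ i"] le[of i] by (cases "ext_utility U (x' $ i)") auto
  then obtain v where v: "\<And>i. ext_utility U (x' $ i) = ereal (v i)" by metis
  have "(\<Sum>i\<in>UNIV. \<nu> $ i * w i) < (\<Sum>i\<in>UNIV. \<nu> $ i * v i)"
    using le less \<nu> unfolding v
    by (intro sum_strict_mono_ex1) (auto intro!: mult_left_mono simp: less_imp_le)
  then show ?thesis
    using sums by (simp add: total_utility_real[OF u] total_utility_real[OF v])
qed

text \<open>The midpoint of two different maximisers is feasible, and strict concavity gives a gain
  in every coordinate where they differ.\<close>

lemma optimal_allocation_unique:
  assumes U: "utility U" and net: "\<And>i. R i \<noteq> {}" "\<And>j. 0 < C j" "\<And>i. 0 < \<nu> $ i"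
    and opt: "optimal_allocation U R C \<nu> x" "optimal_allocation U R C \<nu> x'"
  shows "x = x'"
proof (rule ccontr)
  assume "x \<noteq> x'"
  then obtain k where k: "x $ k \<noteq> x' $ k" by (auto simp: vec_eq_iff)
  obtain u where u: "\<And>i. ext_utility U (x $ i) = ereal (u i)"
    using optimal_allocation_finite[OF net opt(1)] by blast
  obtain u' where u': "\<And>i. ext_utility U (x' $ i) = ereal (u' i)"
    using optimal_allocation_finite[OF net opt(2)] by blast
  have f: "feasible R C \<nu> x" "feasible R C \<nu> x'"
    using opt by (auto simp: optimal_allocation_def)
  define z where "z = (1 - 1 / 2) *\<^sub>R x + (1 / 2 :: real) *\<^sub>R x'"
  have z: "feasible R C \<nu> z"
    unfolding z_def using f by (intro feasible_convex) auto
  define w where "w i = (1 - 1 / 2) * u i + 1 / 2 * u' i" for i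
  have conc: "ereal (w i) < ext_utility U (z $ i)" if "x $ i \<noteq> x' $ i" for i
    using ext_utility_strictly_concave[OF U _ _ that u u', of "1 / 2"] f
    by (simp add: w_def z_def feasible_nonneg)
  have eq: "ereal (w i) = ext_utility U (z $ i)" if "x $ i = x' $ i" for i
    using u[of i] u'[of i] that by (simp add: w_def z_def)
  have "total_utility U \<nu> x = total_utility U \<nu> x'"
    using opt by (auto simp: optimal_allocation_def intro: antisym)
  then have "(\<Sum>i\<in>UNIV. \<nu> $ i * u i) = (\<Sum>i\<in>UNIV. \<nu> $ i * u' i)"
    by (simp add: total_utility_real[OF u] total_utility_real[OF u'])
  then have "(\<Sum>i\<in>UNIV. \<nu> $ i * u i) = (\<Sum>i\<in>UNIV. \<nu> $ i * w i)"
    by (simp add: w_def distrib_left sum.distrib sum_divide_distrib[symmetric])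
  then have "total_utility U \<nu> x < total_utility U \<nu> z"
    using conc eq k by (intro total_utility_less[OF u net(3), of w _ k])
      (metis order_le_less, blast, simp)
  then show False
    using opt(1) z by (auto simp: optimal_allocation_def not_le[symmetric])
qed

lemma allocation_optimal:
  assumes "utility U" "\<And>i. R i \<noteq> {}" "\<And>j. 0 < C j" "\<And>i. 0 < \<nu> $ i"
  shows "optimal_allocation U R C \<nu> (allocation U R C \<nu>)"
proof -
  have "\<exists>!x. optimal_allocation U R C \<nu> x"
    using optimal_allocation_exists[OF assms] optimal_allocation_unique[OF assms]
    by (rule ex_ex1I)
  then show ?thesis
    unfolding allocation_def by (rule theI')
qed

section \<open>The bottleneck of the optimal allocation\<close>

text \<open>Spare capacity of \<open>j\<close> could be handed to user \<open>k\<close>, which would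
  increase the total utility.\<close>

lemma optimal_allocation_saturates:
  assumes U: "utility U" and net: "\<And>i. R i \<noteq> {}" "\<And>j. 0 < C j" "\<And>i. 0 < \<nu> $ i"
    and opt: "optimal_allocation U R C \<nu> x" and y: "routing R C \<nu> x y" and j: "j \<in> R k"
  shows "(\<Sum>i | j \<in> R i. \<nu> $ i * y i j) = C j"
proof (rule ccontr)
  \<comment> \<open>The rate increase per flow of user \<open>k\<close> that uses up exactly the
    spare capacity.\<close>
  define e where "e = (C j - (\<Sum>i | j \<in> R i. \<nu> $ i * y i j)) / \<nu> $ k"
  assume "(\<Sum>i | j \<in> R i. \<nu> $ i * y i j) \<noteq> C j"
  then have "(\<Sum>i | j \<in> R i. \<nu> $ i * y i j) < C j"
    using y by (simp add: routing_def order_less_le)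
  then have e: "0 < e" using net(3)[of k] by (simp add: e_def)
  define d where "d i = (if i = k then e else 0)" for i
  define x' where "x' = (\<chi> i. x $ i + d i)"
  have "(\<Sum>i | j \<in> R i. \<nu> $ i * d i) = \<nu> $ k * e"
    using j by (simp add: d_def if_distrib[of "\<lambda>z. _ * z"] sum.If_cases Int_def conj_commute
        cong: if_cong conj_cong)
  then have feas: "feasible R C \<nu> x'"
    unfolding x'_def using y j e net(3)[of k]
    by (intro routing_shift[OF y, of j])
      (auto simp: d_def[abs_def] routing_def distrib_left sum.distrib e_def)
  obtain u where u: "\<And>i. ext_utility U (x $ i) = ereal (u i)"
    using optimal_allocation_finite[OF net opt] by blast
  have "0 \<le> x $ k" using opt by (auto simp: optimal_allocation_def feasible_nonneg)
  then have "total_utility U \<nu> x < total_utility U \<nu> x'"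
    using e ext_utility_less[OF U, of "x $ k" "x' $ k"]
    by (intro total_utility_less[OF u net(3), of u _ k])
      (auto simp: u[symmetric] x'_def d_def)
  then show False
    using opt feas by (auto simp: optimal_allocation_def not_le[symmetric])
qed

text \<open>
  If \<open>x\<^sub>i > x\<^sub>k\<close>, moving a little capacity of \<open>j\<close> from \<open>i\<close> to \<open>k\<close> brings the two rates closer
  together while \<open>\<nu>\<^sub>i x\<^sub>i + \<nu>\<^sub>k x\<^sub>k\<close> is unchanged, and concavity makes this an improvement.
\<close>

lemma optimal_allocation_exchange:
  assumes U: "utility U" and net: "\<And>i. R i \<noteq> {}" "\<And>j. 0 < C j" "\<And>i. 0 < \<nu> $ i"
    and opt: "optimal_allocation U R C \<nu> x" and y: "routing R C \<nu> x y"
    and j: "j \<in> R i" "j \<in> R k" and pos: "0 < y i j"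
  shows "x $ i \<le> x $ k"
proof (rule ccontr)
  assume "\<not> x $ i \<le> x $ k"
  then have g: "x $ k < x $ i" by simp
  then have ik: "i \<noteq> k" by auto
  define g where "g = x $ i - x $ k"
  have g0: "0 < g" using g by (simp add: g_def)
  \<comment> \<open>The amount of capacity moved. The first bound keeps the rate of \<open>i\<close>
    at \<open>j\<close> nonnegative; the factor 1/2 in the second makes \<open>s i\<close> and
    \<open>s k\<close> below smaller than 1.\<close>
  define e where "e = min (\<nu> $ i * y i j) (min (\<nu> $ i) (\<nu> $ k) * g / 2)"
  have e: "0 < e" "e \<le> \<nu> $ i * y i j" "e < \<nu> $ i * g" "e < \<nu> $ k * g"
  proof -
    show "0 < e" using pos g0 net(3) by (simp add: e_def)
    show "e \<le> \<nu> $ i * y i j" by (simp add: e_def)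
    have "min (\<nu> $ i) (\<nu> $ k) * g \<le> \<nu> $ i * g" "min (\<nu> $ i) (\<nu> $ k) * g \<le> \<nu> $ k * g"
      using g0 by (auto intro: mult_right_mono)
    moreover have "e \<le> min (\<nu> $ i) (\<nu> $ k) * g / 2" by (simp add: e_def)
    moreover have "0 < \<nu> $ i * g" "0 < \<nu> $ k * g" using g0 net(3) by auto
    ultimately show "e < \<nu> $ i * g" "e < \<nu> $ k * g" by linarith+
  qed
  define d where "d a = (if a = k then e / \<nu> $ k else 0) - (if a = i then e / \<nu> $ i else 0)" for a
  define x' where "x' = (\<chi> a. x $ a + d a)"
  have \<nu>d: "\<nu> $ a * d a = (if a = k then e else 0) - (if a = i then e else 0)" for a
    using net(3)[of a] by (auto simp: d_def right_diff_distrib)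
  have "(\<Sum>a | j \<in> R a. \<nu> $ a * d a) = 0"
    using j by (simp add: \<nu>d sum_subtractf)
  moreover have "e / \<nu> $ i \<le> y i j"
    using e(2) net(3)[of i] by (simp add: field_simps)
  ultimately have feas: "feasible R C \<nu> x'"
    unfolding x'_def using y j e net(3)[of k]
    by (intro routing_shift[OF y, of j])
      (auto simp: d_def[abs_def] routing_def distrib_left sum.distrib)
  obtain u where u: "\<And>i. ext_utility U (x $ i) = ereal (u i)"
    using optimal_allocation_finite[OF net opt] by blast
  have nn: "0 \<le> x $ a" for a using opt by (auto simp: optimal_allocation_def feasible_nonneg)
  \<comment> \<open>The fraction of the gap \<open>g\<close> by which the rate of \<open>a\<close>
    moves, so the new rates of \<open>i\<close> and \<open>k\<close> are convex combinations of the
    old ones.\<close>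
  define s where "s a = e / (\<nu> $ a * g)" for a
  have s: "0 < s i" "s i < 1" "0 < s k" "s k < 1"
    using e g0 net(3) by (auto simp: s_def)
  have sg: "s a * g = e / \<nu> $ a" for a
    using g0 by (simp add: s_def)
  define w where "w a = (if a = i then (1 - s i) * u i + s i * u k
      else if a = k then (1 - s k) * u k + s k * u i else u a)" for a
  have x'i: "x' $ i = (1 - s i) * x $ i + s i * x $ k"
    using sg[of i] ik by (simp add: x'_def d_def g_def algebra_simps)
  have x'k: "x' $ k = (1 - s k) * x $ k + s k * x $ i"
    using sg[of k] ik by (simp add: x'_def d_def g_def algebra_simps)
  have wi: "ereal (w i) < ext_utility U (x' $ i)"
    unfolding x'i w_def
    using ext_utility_strictly_concave[OF U nn nn _ u u s(1,2)] g by simp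
  have wk: "ereal (w k) < ext_utility U (x' $ k)"
    unfolding x'k w_def
    using ext_utility_strictly_concave[OF U nn nn _ u u s(3,4)] g ik by simp
  have wa: "ereal (w a) \<le> ext_utility U (x' $ a)" for a
    using wi wk by (cases "a = i"; cases "a = k") (auto simp: less_imp_le w_def u x'_def d_def)
  \<comment> \<open>Since \<open>\<nu> $ a * s a\<close> is \<open>e / g\<close> for both users, the
    two changes of the concavity bound cancel.\<close>
  have "\<nu> $ a * w a = \<nu> $ a * u a + (if a = i then (e / g) * (u k - u i) else 0)
      + (if a = k then (e / g) * (u i - u k) else 0)" for a
  proof -
    have "\<nu> $ a * s a = e / g"
      using net(3)[of a] by (simp add: s_def)
    moreover have "\<nu> $ a * ((1 - s a) * p + s a * q) = \<nu> $ a * p + \<nu> $ a * s a * (q - p)" for p q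
      by (simp add: algebra_simps)
    ultimately show ?thesis using ik by (auto simp: w_def)
  qed
  then have "(\<Sum>a\<in>UNIV. \<nu> $ a * w a) = (\<Sum>a\<in>UNIV. \<nu> $ a * u a)"
    by (simp add: sum.distrib algebra_simps)
  then have "total_utility U \<nu> x < total_utility U \<nu> x'"
    using wa wi by (intro total_utility_less[OF u net(3), of w _ i]) auto
  then show False
    using opt feas by (auto simp: optimal_allocation_def not_le[symmetric])
qed

text \<open>Take the users \<open>L\<close> of minimal rate and the union \<open>J'\<close> of their
  routes. By the exchange argument nobody outside \<open>L\<close> gets anything from
  \<open>J'\<close>, and by saturation \<open>L\<close> uses all of it.\<close>

lemma optimal_allocation_bottleneck:
  fixes R :: "'i::finite \<Rightarrow> 'j::finite set"
  assumes U: "utility U" and net: "\<And>i. R i \<noteq> {}" "\<And>j. 0 < C j" "\<And>i. 0 < \<nu> $ i"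
    and opt: "optimal_allocation U R C \<nu> x"
  obtains a J' where "users_within R J' \<noteq> {}" "\<And>i. a \<le> x $ i"
    "\<And>i. i \<in> users_within R J' \<Longrightarrow> x $ i = a"
    "(\<Sum>i\<in>users_within R J'. \<nu> $ i) * a = (\<Sum>j\<in>J'. C j)"
proof -
  obtain y where y: "routing R C \<nu> x y"
    using opt by (auto simp: optimal_allocation_def feasible_iff_routing)
  define a where "a = Min (range (($) x))"
  have a_le: "a \<le> x $ i" for i by (simp add: a_def)
  have a_in: "a \<in> range (($) x)" unfolding a_def by (rule Min_in) auto
  define L where "L = {i. x $ i = a}"
  define J' where "J' = (\<Union>i\<in>L. R i)"
  have used: "i \<in> L" if "j \<in> J'" "j \<in> R i" "0 < y i j" for i j
  proof -
    obtain k where "k \<in> L" "j \<in> R k" using \<open>j \<in> J'\<close> by (auto simp: J'_def)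
    then show ?thesis
      using optimal_allocation_exchange[OF U net opt y _ _ that(3), of k] that a_le[of i]
      by (simp add: L_def)
  qed
  \<comment> \<open>A user outside \<open>L\<close> with its route inside \<open>J'\<close> would
    have rate 0; as \<open>0 \<le> a\<close>, that rate would be minimal.\<close>
  have L: "users_within R J' = L"
  proof (intro equalityI subsetI)
    fix i assume i: "i \<in> users_within R J'"
    show "i \<in> L"
    proof (rule ccontr)
      assume "i \<notin> L"
      then have "y i j = 0" if "j \<in> R i" for j
        using used[of j i] that i y by (force simp: users_within_def routing_def)
      moreover have "x $ i = (\<Sum>j\<in>R i. y i j)" using y by (simp add: routing_def)
      ultimately have "x $ i = 0" by simp
      moreover have "0 \<le> a"
        using a_in opt feasible_nonneg by (auto simp: optimal_allocation_def)
      ultimately show False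
        using \<open>i \<notin> L\<close> a_le[of i] by (simp add: L_def)
    qed
  qed (auto simp: users_within_def J'_def)
  \<comment> \<open>Capacity equals load by saturation, the users outside \<open>L\<close>
    contribute nothing, and those in \<open>L\<close> contribute their full rate
    \<open>a\<close>.\<close>
  have "(\<Sum>j\<in>J'. C j) = (\<Sum>j\<in>J'. \<Sum>i | j \<in> R i. \<nu> $ i * y i j)"
  proof (rule sum.cong[OF refl])
    fix j assume "j \<in> J'"
    then obtain k where "j \<in> R k" by (auto simp: J'_def)
    then show "C j = (\<Sum>i | j \<in> R i. \<nu> $ i * y i j)"
      using optimal_allocation_saturates[OF U net opt y] by simp
  qed
  also have "\<dots> = (\<Sum>i\<in>UNIV. \<Sum>j\<in>R i \<inter> J'. \<nu> $ i * y i j)"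
    by (rule sum_routes_swap)
  also have "\<dots> = (\<Sum>i\<in>L. \<Sum>j\<in>R i \<inter> J'. \<nu> $ i * y i j)"
  proof (rule sum.mono_neutral_right)
    show "\<forall>i\<in>UNIV - L. (\<Sum>j\<in>R i \<inter> J'. \<nu> $ i * y i j) = 0"
    proof (intro ballI sum.neutral)
      fix i j assume "i \<in> UNIV - L" "j \<in> R i \<inter> J'"
      then have "\<not> 0 < y i j" "0 \<le> y i j" using used y by (auto simp: routing_def)
      then show "\<nu> $ i * y i j = 0" by simp
    qed
  qed auto
  also have "\<dots> = (\<Sum>i\<in>L. \<nu> $ i * a)"
  proof (rule sum.cong[OF refl])
    fix i assume i: "i \<in> L"
    then have "R i \<inter> J' = R i" by (auto simp: J'_def)
    then have "(\<Sum>j\<in>R i \<inter> J'. \<nu> $ i * y i j) = \<nu> $ i * x $ i"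
      using y by (simp add: routing_def sum_distrib_left[symmetric])
    then show "(\<Sum>j\<in>R i \<inter> J'. \<nu> $ i * y i j) = \<nu> $ i * a"
      using i by (simp add: L_def)
  qed
  finally have "(\<Sum>i\<in>users_within R J'. \<nu> $ i) * a = (\<Sum>j\<in>J'. C j)"
    by (simp add: L sum_distrib_right)
  moreover have "users_within R J' \<noteq> {}" using a_in by (auto simp: L L_def)
  moreover have "x $ i = a" if "i \<in> users_within R J'" for i
    using that by (simp add: L L_def)
  ultimately show ?thesis
    by (intro that[of J' a] a_le)
qed

section \<open>Complete resource pooling\<close>

text \<open>If \<open>J'\<close> is not strongly connected, it splits into \<open>J1\<close> and
  \<open>J2\<close> such that each user within \<open>J'\<close> is within one of them. Both sums
  are then additive, and induction on the cardinality applies.\<close>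

lemma strongly_connected_additive_pos:
  fixes R :: "'i::finite \<Rightarrow> 'j::finite set" and f :: "'i \<Rightarrow> real" and g :: "'j \<Rightarrow> real"
  assumes routes: "\<And>i. R i \<noteq> {}"
    and sc: "\<And>J'. J' \<in> strongly_connected_sets R \<Longrightarrow> J' \<noteq> UNIV \<Longrightarrow>
      (\<Sum>i\<in>users_within R J'. f i) < (\<Sum>j\<in>J'. g j)"
    and "J' \<noteq> {}" "J' \<noteq> UNIV"
  shows "(\<Sum>i\<in>users_within R J'. f i) < (\<Sum>j\<in>J'. g j)"
  using assms(3,4)
proof (induction "card J'" arbitrary: J' rule: less_induct)
  case less
  show ?case
  proof (cases "J' \<in> strongly_connected_sets R")
    case True
    then show ?thesis using sc less.prems by blast
  next
    case False
    then have "\<not> connected_pair R (users_within R J') J'"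
      using less.prems(1) by (simp add: strongly_connected_sets_def)
    then obtain J1 J2 I1 I2 where J: "J1 \<noteq> {}" "J2 \<noteq> {}" "J1 \<union> J2 = J'" "J1 \<inter> J2 = {}"
      and I: "I1 \<union> I2 = users_within R J'" "I1 \<inter> I2 = {}"
        "\<forall>i\<in>I1. R i \<inter> J2 = {}" "\<forall>i\<in>I2. R i \<inter> J1 = {}"
      unfolding connected_pair_def not_not by (elim exE conjE) (rule that)
    have "J1 \<subset> J'" "J2 \<subset> J'" using J by auto
    then have "card J1 < card J'" "card J2 < card J'" "J1 \<noteq> UNIV" "J2 \<noteq> UNIV"
      by (auto intro: psubset_card_mono)
    then have IH: "(\<Sum>i\<in>users_within R J1. f i) < (\<Sum>j\<in>J1. g j)"
        "(\<Sum>i\<in>users_within R J2. f i) < (\<Sum>j\<in>J2. g j)"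
      using less.hyps J by auto
    \<comment> \<open>A user within both parts would have an empty route.\<close>
    have dj: "users_within R J1 \<inter> users_within R J2 = {}"
      using routes J(4) by (fastforce simp: users_within_def)
    have "R i \<subseteq> J1 \<or> R i \<subseteq> J2" if "R i \<subseteq> J'" for i
    proof -
      have "i \<in> I1 \<union> I2" using that I(1) by (simp add: users_within_def)
      then show ?thesis using I(3,4) that J(3) by blast
    qed
    then have "users_within R J' = users_within R J1 \<union> users_within R J2"
      using J(3) by (auto simp: users_within_def)
    then have "(\<Sum>i\<in>users_within R J'. f i) =
        (\<Sum>i\<in>users_within R J1. f i) + (\<Sum>i\<in>users_within R J2. f i)"
      using dj by (simp add: sum.union_disjoint)
    moreover have "(\<Sum>j\<in>J'. g j) = (\<Sum>j\<in>J1. g j) + (\<Sum>j\<in>J2. g j)"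
      using J by (metis finite_class.finite sum.union_disjoint)
    ultimately show ?thesis using IH by linarith
  qed
qed

text \<open>Pooling is tested by finitely many strict cut inequalities. Necessity uses feasibility
  of the equal share at a perturbed state, sufficiency the bottleneck at every nearby state.\<close>

lemma complete_resource_pooling_iff:
  fixes R :: "'i::finite \<Rightarrow> 'j::finite set" and \<nu> :: "real ^ 'i"
  assumes U: "utility U" and net: "\<And>i. R i \<noteq> {}" "\<And>j. 0 < C j" and \<nu>: "\<And>i. 0 < \<nu> $ i"
  shows "complete_resource_pooling U R C \<nu> \<longleftrightarrow>
    (\<forall>J'. J' \<noteq> UNIV \<longrightarrow> users_within R J' \<noteq> {} \<longrightarrow>
       (\<Sum>i\<in>users_within R J'. \<nu> $ i) * (\<Sum>j\<in>UNIV. C j) < (\<Sum>j\<in>J'. C j) * (\<Sum>i\<in>UNIV. \<nu> $ i))"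
    (is "_ \<longleftrightarrow> (\<forall>J'. _ \<longrightarrow> _ \<longrightarrow> ?cut \<nu> J')")
proof
  assume "complete_resource_pooling U R C \<nu>"
  then obtain S where S: "open S" "\<nu> \<in> S"
      "\<And>\<nu>' i. \<nu>' \<in> S \<Longrightarrow> allocation U R C \<nu>' $ i = (\<Sum>j\<in>UNIV. C j) / (\<Sum>i'\<in>UNIV. \<nu>' $ i')"
    by (auto simp: complete_resource_pooling_def)
  show "\<forall>J'. J' \<noteq> UNIV \<longrightarrow> users_within R J' \<noteq> {} \<longrightarrow> ?cut \<nu> J'"
  proof (intro allI impI)
    fix J' :: "'j set"
    assume J': "J' \<noteq> UNIV" "users_within R J' \<noteq> {}"
    then obtain k where k: "k \<in> users_within R J'" by auto
    \<comment> \<open>Adding \<open>e\<close> flows of a user within \<open>J'\<close> raises both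
      flow sums in the cut inequality by \<open>e\<close>.\<close>
    have "((\<lambda>e. \<nu> + e *\<^sub>R axis k 1) \<longlongrightarrow> \<nu> + 0 *\<^sub>R axis k 1) (at_right (0::real))"
      by (intro tendsto_intros)
    then have "\<forall>\<^sub>F e in at_right (0::real). \<nu> + e *\<^sub>R axis k 1 \<in> S"
      by (intro topological_tendstoD) (use S in auto)
    then have "\<forall>\<^sub>F e in at_right (0::real). 0 < e \<and> \<nu> + e *\<^sub>R axis k 1 \<in> S"
      using eventually_at_right_less[of "0::real"] by eventually_elim simp
    then obtain e where e: "0 < e" "\<nu> + e *\<^sub>R axis k 1 \<in> S"
      using eventually_happens[of _ "at_right (0::real)"] by auto
    define \<nu>' where "\<nu>' = \<nu> + e *\<^sub>R axis k 1"
    have \<nu>'_nth: "\<nu>' $ i = \<nu> $ i + (if i = k then e else 0)" for i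
      by (simp add: \<nu>'_def axis_def)
    have \<nu>': "0 < \<nu>' $ i" for i using \<nu>[of i] e by (auto simp: \<nu>'_nth intro: add_pos_pos)
    have sums: "(\<Sum>i\<in>users_within R J'. \<nu>' $ i) = (\<Sum>i\<in>users_within R J'. \<nu> $ i) + e"
        "(\<Sum>i\<in>UNIV. \<nu>' $ i) = (\<Sum>i\<in>UNIV. \<nu> $ i) + e"
      using k by (simp_all add: \<nu>'_nth sum.distrib)
    have spos: "0 < (\<Sum>i\<in>UNIV. \<nu>' $ i)" using \<nu>' by (intro sum_pos) auto
    have "feasible R C \<nu>' (allocation U R C \<nu>')"
      using allocation_optimal[OF U net \<nu>'] by (simp add: optimal_allocation_def)
    from feasible_cut[OF this, of J']
    have "(\<Sum>i\<in>users_within R J'. \<nu>' $ i) * ((\<Sum>j\<in>UNIV. C j) / (\<Sum>i\<in>UNIV. \<nu>' $ i)) \<le> (\<Sum>j\<in>J'. C j)"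
      using \<nu>' S(3)[OF e(2)]
      by (simp add: less_imp_le \<nu>'_def[symmetric] sum_distrib_right del: times_divide_eq_right)
    then have le: "((\<Sum>i\<in>users_within R J'. \<nu> $ i) + e) * (\<Sum>j\<in>UNIV. C j) \<le>
        (\<Sum>j\<in>J'. C j) * ((\<Sum>i\<in>UNIV. \<nu> $ i) + e)"
      using spos unfolding sums[symmetric] by (simp add: pos_divide_le_eq)
    obtain b where "b \<notin> J'" using J'(1) by auto
    then have "(\<Sum>j\<in>J'. C j) < (\<Sum>j\<in>UNIV. C j)"
      using net(2) by (intro sum_strict_mono2[of _ _ b]) (auto simp: less_imp_le)
    \<comment> \<open>Subtracting this strict inequality from the weak one at \<open>\<nu>'\<close>
      leaves the strict cut at \<open>\<nu>\<close>.\<close>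
    then have "e * (\<Sum>j\<in>J'. C j) < e * (\<Sum>j\<in>UNIV. C j)"
      using e(1) by simp
    then show "?cut \<nu> J'" using le by (simp add: algebra_simps)
  qed
next
  assume cut: "\<forall>J'. J' \<noteq> UNIV \<longrightarrow> users_within R J' \<noteq> {} \<longrightarrow> ?cut \<nu> J'"
  define S where "S = {\<nu>'. (\<forall>i. 0 < \<nu>' $ i) \<and>
      (\<forall>J'. J' \<noteq> UNIV \<longrightarrow> users_within R J' \<noteq> {} \<longrightarrow> ?cut \<nu>' J')}"
  have "S = (\<Inter>i. {\<nu>'. 0 < \<nu>' $ i}) \<inter>
      (\<Inter>J'\<in>{J'. J' \<noteq> UNIV \<and> users_within R J' \<noteq> {}}. {\<nu>'. ?cut \<nu>' J'})"
    by (auto simp: S_def)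
  moreover have "open \<dots>"
    by (intro open_Int open_INT ballI open_Collect_less continuous_intros) auto
  ultimately have "open S" by simp
  moreover have "\<nu> \<in> S" using cut \<nu> by (simp add: S_def)
  moreover have "allocation U R C \<nu>' $ i = (\<Sum>j\<in>UNIV. C j) / (\<Sum>i'\<in>UNIV. \<nu>' $ i')"
    if "\<nu>' \<in> S" for \<nu>' i
  proof -
    define x where "x = allocation U R C \<nu>'"
    have pos: "0 < \<nu>' $ i" for i using that by (simp add: S_def)
    have opt: "optimal_allocation U R C \<nu>' x"
      unfolding x_def using U net pos by (rule allocation_optimal)
    obtain a J' where J': "users_within R J' \<noteq> {}" "\<And>i. a \<le> x $ i"
        "\<And>i. i \<in> users_within R J' \<Longrightarrow> x $ i = a"
        "(\<Sum>i\<in>users_within R J'. \<nu>' $ i) * a = (\<Sum>j\<in>J'. C j)"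
      by (rule optimal_allocation_bottleneck[OF U net pos opt]) (rule that)
    have spos: "0 < (\<Sum>i\<in>UNIV. \<nu>' $ i)" "0 < (\<Sum>i\<in>users_within R J'. \<nu>' $ i)"
      using pos J'(1) by (auto intro!: sum_pos)
    \<comment> \<open>At a proper bottleneck the cut inequality would put the minimal rate
      \<open>a\<close> above the equal share, and the total demand would exceed the total
      capacity.\<close>
    have "J' = UNIV"
    proof (rule ccontr)
      assume "J' \<noteq> UNIV"
      then have "?cut \<nu>' J'" using that J'(1) by (simp add: S_def)
      then have "(\<Sum>j\<in>UNIV. C j) < a * (\<Sum>i\<in>UNIV. \<nu>' $ i)"
        using spos(2) unfolding J'(4)[symmetric] by (simp add: mult.assoc)
      also have "\<dots> \<le> (\<Sum>i\<in>UNIV. \<nu>' $ i * x $ i)"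
        using J'(2) pos unfolding sum_distrib_left
        by (intro sum_mono) (simp add: mult.commute[of a])
      also have "\<dots> \<le> (\<Sum>j\<in>UNIV. C j)"
        using feasible_cut[of R C \<nu>' x UNIV] opt pos
        by (simp add: optimal_allocation_def users_within_def less_imp_le)
      finally show False by simp
    qed
    then show ?thesis
      using J'(3,4) spos(1) by (simp add: users_within_def x_def[symmetric] field_simps)
  qed
  ultimately show "complete_resource_pooling U R C \<nu>"
    unfolding complete_resource_pooling_def by blast
qed

theorem theorem5p6:
  fixes U :: "real \<Rightarrow> real"
    and R :: "'i::finite \<Rightarrow> 'j::finite set"
    and C :: "'j \<Rightarrow> real"
    and lam mu kap eta rho :: "'i \<Rightarrow> real"
    and n m :: "real ^ 'i"
  assumes utility: "utility U"
    and routes: "\<And>i. R i \<noteq> {}"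
    and capacities: "\<And>j. 0 < C j"
    and rates: "\<And>i. 0 < lam i" "\<And>i. 0 < mu i" "\<And>i. 0 < kap i" "\<And>i. 0 < eta i"
    and rho: "\<And>i. rho i = lam i / mu i"
    and stability: "\<And>J'. J' \<in> strongly_connected_sets R \<Longrightarrow>
          (\<Sum>i\<in>users_within R J'. rho i) < (\<Sum>j\<in>J'. C j)"
    and equilibrium: "fluid_equilibrium U R C lam mu kap eta n m"
  shows "complete_resource_pooling U R C (n + m) \<longleftrightarrow>
    (\<forall>J'\<in>strongly_connected_sets R. J' \<noteq> UNIV \<longrightarrow>
       users_within R J' = {} \<or>
       (\<Sum>i\<in>- users_within R J'. rho i) - (\<Sum>j\<in>- J'. C j) >
         - ((\<Sum>i\<in>- users_within R J'. kap i / eta i) / (\<Sum>i\<in>users_within R J'. kap i / eta i))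
           * ((\<Sum>j\<in>J'. C j) - (\<Sum>i\<in>users_within R J'. rho i)))"
proof -
  define M where "M i = kap i / eta i" for i
  have M: "0 < M i" for i using rates by (simp add: M_def)
  have m: "m $ i = M i" and n: "mu i * (n $ i * allocation U R C (n + m) $ i) = lam i"
    and n0: "0 \<le> n $ i" for i
    using equilibrium rates[of i]
    by (auto simp: fluid_equilibrium_def fluid_drift_def M_def zero_prod_def vec_eq_iff field_simps)
  define \<nu> where "\<nu> = n + m"
  define x where "x = allocation U R C \<nu>"
  have \<nu>: "0 < \<nu> $ i" for i using n0[of i] M[of i] by (simp add: \<nu>_def m)
  have opt: "optimal_allocation U R C \<nu> x"
    unfolding x_def using utility routes capacities \<nu> by (rule allocation_optimal)
  \<comment> \<open>At equilibrium the elastic flows of user \<open>i\<close> consume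
    \<open>rho i\<close>; the streaming flows consume the rest.\<close>
  have \<nu>x: "\<nu> $ i * x $ i = rho i + M i * x $ i" for i
    using n[of i] rates(2)[of i]
    by (simp add: rho x_def \<nu>_def m distrib_right field_simps)
  define P where "P J' = (\<Sum>i\<in>users_within R J'. rho i)" for J'
  define Q where "Q J' = (\<Sum>i\<in>users_within R J'. M i)" for J'
  define N where "N J' = (\<Sum>i\<in>users_within R J'. \<nu> $ i)" for J'
  define D where "D J' = (\<Sum>j\<in>J'. C j)" for J'
  have all: "users_within R UNIV = UNIV" by (auto simp: users_within_def)
  have NUNIV: "0 < N UNIV" unfolding N_def using \<nu> by (intro sum_pos) (auto simp: all)
  \<comment> \<open>Write the sums over complements as differences and multiply by
    \<open>Q J'\<close>, which is positive when \<open>J'\<close> has users.\<close>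
  have cond: "((\<Sum>i\<in>- users_within R J'. rho i) - (\<Sum>j\<in>- J'. C j) >
         - ((\<Sum>i\<in>- users_within R J'. M i) / (\<Sum>i\<in>users_within R J'. M i))
           * ((\<Sum>j\<in>J'. C j) - (\<Sum>i\<in>users_within R J'. rho i))) \<longleftrightarrow>
      Q J' * (D UNIV - P UNIV) < Q UNIV * (D J' - P J')"
    if "users_within R J' \<noteq> {}" for J'
  proof -
    have Q: "0 < Q J'" unfolding Q_def using M that by (intro sum_pos) auto
    have compl: "(\<Sum>i\<in>- users_within R J'. rho i) = P UNIV - P J'"
        "(\<Sum>i\<in>- users_within R J'. M i) = Q UNIV - Q J'" "(\<Sum>j\<in>- J'. C j) = D UNIV - D J'"
      by (simp_all add: P_def Q_def D_def all Compl_eq_Diff_UNIV sum_diff)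
    have "(- ((Q UNIV - Q J') / Q J') * (D J' - P J') < P UNIV - P J' - (D UNIV - D J')) \<longleftrightarrow>
        (- (Q UNIV - Q J') * (D J' - P J') < (P UNIV - P J' - (D UNIV - D J')) * Q J')"
      by (simp only: minus_divide_left times_divide_eq_left pos_divide_less_eq[OF Q])
    also have "\<dots> \<longleftrightarrow> Q J' * (D UNIV - P UNIV) < Q UNIV * (D J' - P J')"
      by (simp add: algebra_simps)
    finally show ?thesis
      unfolding compl by (simp only: P_def[symmetric] Q_def[symmetric] D_def[symmetric])
  qed
  \<comment> \<open>With a common rate \<open>a\<close> the cut reads
    \<open>Q J' * a < D J' - P J'\<close>. Balance over the whole network gives
    \<open>Q UNIV * a = D UNIV - P UNIV\<close>, which eliminates \<open>a\<close>.\<close>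
  have pooled: "N J' * D UNIV < D J' * N UNIV \<longleftrightarrow>
      Q J' * (D UNIV - P UNIV) < Q UNIV * (D J' - P J')"
    if x: "\<And>i. x $ i = D UNIV / N UNIV" for J'
  proof -
    define a where "a = D UNIV / N UNIV"
    have a: "P J' + Q J' * a = N J' * a" for J'
      using \<nu>x x[folded a_def] unfolding P_def Q_def N_def
      by (simp add: sum_distrib_right sum.distrib[symmetric])
    have aN: "N UNIV * a = D UNIV" using NUNIV by (simp add: a_def)
    have Q: "0 < Q UNIV" unfolding Q_def using M by (intro sum_pos) (auto simp: all)
    have "N J' * D UNIV < D J' * N UNIV \<longleftrightarrow> N J' * a < D J'"
      using NUNIV by (simp add: a_def pos_divide_less_eq)
    also have "\<dots> \<longleftrightarrow> Q J' * a < D J' - P J'"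
      using a[of J'] by auto
    also have "\<dots> \<longleftrightarrow> Q UNIV * (Q J' * a) < Q UNIV * (D J' - P J')"
      using Q by simp
    also have "Q UNIV * (Q J' * a) = Q J' * (D UNIV - P UNIV)"
    proof -
      have "D UNIV - P UNIV = Q UNIV * a" using a[of UNIV] aN by linarith
      then show ?thesis by simp
    qed
    finally show ?thesis .
  qed
  have crp: "complete_resource_pooling U R C (n + m) \<longleftrightarrow>
      (\<forall>J'. J' \<noteq> UNIV \<longrightarrow> users_within R J' \<noteq> {} \<longrightarrow> N J' * D UNIV < D J' * N UNIV)"
    using complete_resource_pooling_iff[OF utility routes capacities \<nu>]
    by (simp add: N_def D_def all \<nu>_def)
  have "complete_resource_pooling U R C (n + m) \<longleftrightarrow>
      (\<forall>J'\<in>strongly_connected_sets R. J' \<noteq> UNIV \<longrightarrow> users_within R J' = {} \<or>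
         Q J' * (D UNIV - P UNIV) < Q UNIV * (D J' - P J'))" (is "?crp \<longleftrightarrow> ?sc")
  proof
    assume ?crp
    then have "x $ i = D UNIV / N UNIV" for i
      by (auto simp: complete_resource_pooling_def x_def \<nu>_def D_def N_def all)
    with \<open>?crp\<close> show ?sc using pooled crp by blast
  next
    assume sc: ?sc
    have cut: "Q J' * (D UNIV - P UNIV) < Q UNIV * (D J' - P J')"
      if J': "J' \<noteq> UNIV" "users_within R J' \<noteq> {}" for J'
    proof -
      \<comment> \<open>Weights that collect the user terms on the left and the capacities on the
        right, so that the cut inequality becomes a comparison of two additive sums.\<close>
      define f where "f i = M i * (D UNIV - P UNIV) + Q UNIV * rho i" for i
      define g where "g j = Q UNIV * C j" for j
      have f: "(\<Sum>i\<in>users_within R J'. f i) = Q J' * (D UNIV - P UNIV) + Q UNIV * P J'" for J'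
        by (simp add: f_def sum.distrib Q_def P_def sum_distrib_left sum_distrib_right)
      have g: "(\<Sum>j\<in>J'. g j) = Q UNIV * D J'" for J'
        by (simp add: g_def D_def sum_distrib_left)
      have Q: "0 < Q UNIV" unfolding Q_def using M by (intro sum_pos) (auto simp: all)
      have "(\<Sum>i\<in>users_within R J'. f i) < (\<Sum>j\<in>J'. g j)"
      proof (rule strongly_connected_additive_pos[OF routes _ _ J'(1)])
        show "J' \<noteq> {}" using J'(2) routes by (auto simp: users_within_def)
        fix K assume K: "K \<in> strongly_connected_sets R" "K \<noteq> UNIV"
        show "(\<Sum>i\<in>users_within R K. f i) < (\<Sum>j\<in>K. g j)"
        proof (cases "users_within R K = {}")
          \<comment> \<open>The condition exempts sets without users; there the left sum is empty
            and the right one positive.\<close>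
          case True
          have "0 < D K" unfolding D_def
            using K(1) capacities by (intro sum_pos) (auto simp: strongly_connected_sets_def)
          then show ?thesis using Q True unfolding g by simp
        next
          case False
          then show ?thesis using sc K unfolding f g by (auto simp: right_diff_distrib)
        qed
      qed
      then show ?thesis unfolding f g by (simp add: right_diff_distrib)
    qed
    obtain a J' where J': "users_within R J' \<noteq> {}" "\<And>i. a \<le> x $ i"
        "\<And>i. i \<in> users_within R J' \<Longrightarrow> x $ i = a" "N J' * a = D J'"
      unfolding N_def D_def
      by (rule optimal_allocation_bottleneck[OF utility routes capacities \<nu> opt])
        (rule that[unfolded N_def D_def])
    have "J' = UNIV"
    proof (rule ccontr)
      assume "J' \<noteq> UNIV"
      \<comment> \<open>What the elastic load leaves of \<open>J'\<close> is consumed by the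
        streaming flows at rate \<open>a\<close>.\<close>
      have bottleneck: "D J' - P J' = Q J' * a"
      proof -
        have "\<nu> $ i * a = rho i + M i * a" if "i \<in> users_within R J'" for i
          using \<nu>x[of i] J'(3)[OF that] by simp
        then have "N J' * a = P J' + Q J' * a"
          by (simp add: N_def P_def Q_def sum.distrib sum_distrib_right)
        then show ?thesis using J'(4) by simp
      qed
      have Q: "0 < Q J'" unfolding Q_def using M J'(1) by (intro sum_pos) auto
      have "Q J' * (D UNIV - P UNIV) < Q J' * (Q UNIV * a)"
        using cut[OF \<open>J' \<noteq> UNIV\<close> J'(1)] by (simp add: bottleneck mult.left_commute)
      then have "D UNIV - P UNIV < Q UNIV * a" using Q by simp
      \<comment> \<open>All streaming flows have rate at least \<open>a\<close>, yet together they
        cannot consume more than the elastic load leaves of the total capacity.\<close>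
      also have "\<dots> \<le> (\<Sum>i\<in>UNIV. M i * x $ i)"
        using J'(2) M by (simp add: Q_def all sum_distrib_right sum_mono less_imp_le)
      also have "\<dots> = (\<Sum>i\<in>UNIV. \<nu> $ i * x $ i) - P UNIV"
        by (simp add: \<nu>x sum.distrib P_def all)
      also have "\<dots> \<le> D UNIV - P UNIV"
        using feasible_cut[of R C \<nu> x UNIV] opt \<nu>
        by (simp add: optimal_allocation_def all D_def less_imp_le)
      finally show False by simp
    qed
    then have "x $ i = D UNIV / N UNIV" for i
      using J'(3,4) NUNIV by (simp add: all field_simps)
    then show ?crp using pooled crp cut by blast
  qed
  then show ?thesis
    using cond unfolding M_def by blast
qed

end
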